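(* Let $n\geq 2$ be an integer, let $A$ be a non-empty subset of $U(n)$, and let $S$ be a sequence in $\mathbb Z_n$. Then $S$ is a $D$-extremal sequence for $(A,\mathbb Z_n')$ if and only if $S$ has a term equal to $0$ and the sequence obtained from $S$ by deleting one term equal to $0$ is a $D$-extremal sequence for $A$.
   Context: $\mathbb Z_n=\mathbb Z/n\mathbb Z$ as a module over itself, $\mathbb Z_n'=\mathbb Z_n\setminus\{0\}$, $U(n)$ the group of units of $\mathbb Z_n$. A subsequence is a non-empty subfamily of terms in the original order. A sequence $(x_1,\ldots,x_k)$ is an $A$-weighted zero-sum sequence if there exist $a_i\in A$ with $\sum a_ix_i=0$, and an $(A,B)$-weighted zero-sum sequence if there exist $a_i\in A$, $b_i\in B$ with $\sum a_ix_i=0$ and $\sum b_ia_i=0$. $D_{A,B}(n)$ (resp. $D_A(n)$) is the least positive $k$ such that every sequence of length $k$ in $\mathbb Z_n$ has an $(A,B)$-weighted (resp. $A$-weighted) zero-sum subsequence. A $D$-extremal sequence for $(A,B)$ (resp. for $A$) is a sequence of length $D_{A,B}(n)-1$ (resp. $D_A(n)-1$) having no $(A,B)$-weighted (resp. $A$-weighted) zero-sum subsequence. *)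

theory Defs
  imports "HOL-Number_Theory.Residues" "HOL-Library.Sublist"
begin

abbreviation Zn :: "nat \<Rightarrow> int ring" where
  "Zn n \<equiv> residue_ring (int n)"

definition Zn' :: "nat \<Rightarrow> int set" where
  "Zn' n = carrier (Zn n) - {\<zero>\<^bsub>Zn n\<^esub>}"

text \<open>Sequences are lists with entries in the carrier \<open>{0..n-1}\<close>; the weights of a sequence
  are likewise given by lists of the same length. The library operator \<open>finsum\<close> is only
  meaningful for summands in the carrier, so the weight sets \<open>A\<close>, \<open>B\<close> are meant to
  be subsets of the carrier.\<close>

definition weighted_zero_sum :: "nat \<Rightarrow> int set \<Rightarrow> int list \<Rightarrow> bool" where
  "weighted_zero_sum n A x \<longleftrightarrow>
     (\<exists>a. length a = length x \<and> set a \<subseteq> A \<and>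
       (\<Oplus>\<^bsub>Zn n\<^esub>i\<in>{..<length x}. a ! i \<otimes>\<^bsub>Zn n\<^esub> x ! i) = \<zero>\<^bsub>Zn n\<^esub>)"

definition weighted_zero_sum2 :: "nat \<Rightarrow> int set \<Rightarrow> int set \<Rightarrow> int list \<Rightarrow> bool" where
  "weighted_zero_sum2 n A B x \<longleftrightarrow>
     (\<exists>a b. length a = length x \<and> set a \<subseteq> A \<and> length b = length x \<and> set b \<subseteq> B \<and>
       (\<Oplus>\<^bsub>Zn n\<^esub>i\<in>{..<length x}. a ! i \<otimes>\<^bsub>Zn n\<^esub> x ! i) = \<zero>\<^bsub>Zn n\<^esub> \<and>
       (\<Oplus>\<^bsub>Zn n\<^esub>i\<in>{..<length x}. b ! i \<otimes>\<^bsub>Zn n\<^esub> a ! i) = \<zero>\<^bsub>Zn n\<^esub>)"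

text \<open>Subsequences are required to be non-empty, whereas \<open>subseq [] S\<close> always holds.\<close>

definition has_zero_sum_subseq :: "nat \<Rightarrow> int set \<Rightarrow> int list \<Rightarrow> bool" where
  "has_zero_sum_subseq n A S \<longleftrightarrow> (\<exists>T. T \<noteq> [] \<and> subseq T S \<and> weighted_zero_sum n A T)"

definition has_zero_sum_subseq2 :: "nat \<Rightarrow> int set \<Rightarrow> int set \<Rightarrow> int list \<Rightarrow> bool" where
  "has_zero_sum_subseq2 n A B S \<longleftrightarrow>
     (\<exists>T. T \<noteq> [] \<and> subseq T S \<and> weighted_zero_sum2 n A B T)"

text \<open>As usual for \<open>LEAST\<close>, the following two constants are unspecified if no such \<open>k\<close> exists.\<close>

definition Davenport :: "nat \<Rightarrow> int set \<Rightarrow> nat" where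
  "Davenport n A =
     (LEAST k. k > 0 \<and>
       (\<forall>S. set S \<subseteq> carrier (Zn n) \<and> length S = k \<longrightarrow> has_zero_sum_subseq n A S))"

definition Davenport2 :: "nat \<Rightarrow> int set \<Rightarrow> int set \<Rightarrow> nat" where
  "Davenport2 n A B =
     (LEAST k. k > 0 \<and>
       (\<forall>S. set S \<subseteq> carrier (Zn n) \<and> length S = k \<longrightarrow> has_zero_sum_subseq2 n A B S))"

definition D_extremal :: "nat \<Rightarrow> int set \<Rightarrow> int list \<Rightarrow> bool" where
  "D_extremal n A S \<longleftrightarrow>
     set S \<subseteq> carrier (Zn n) \<and> length S = Davenport n A - 1 \<and> \<not> has_zero_sum_subseq n A S"

definition D_extremal2 :: "nat \<Rightarrow> int set \<Rightarrow> int set \<Rightarrow> int list \<Rightarrow> bool" where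
  "D_extremal2 n A B S \<longleftrightarrow>
     set S \<subseteq> carrier (Zn n) \<and> length S = Davenport2 n A B - 1 \<and> \<not> has_zero_sum_subseq2 n A B S"

end

theory Submission
  imports Defs
begin

text \<open>Multiplying a nonzero residue by a unit again gives a nonzero residue, so the
  equation \<open>\<Sum> b\<^sub>i a\<^sub>i = 0\<close> only asks for \<open>k\<close> nonzero residues with sum zero, where \<open>k\<close> is the length. Such
  residues exist for all \<open>k \<ge> 2\<close> if \<open>n \<ge> 3\<close>, and for even \<open>k\<close> if \<open>n = 2\<close>; in the latter
  case a sequence of length at least 3 has two equal terms and these form a zero-sum
  subsequence. Hence \<open>S\<close> has an \<open>(A, Zn')\<close>-weighted zero-sum subsequence iff it has an
  \<open>A\<close>-weighted one of length at least 2. Adding one term 0 therefore turns the sequences without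
  \<open>A\<close>-weighted zero-sum subsequence into the sequences containing 0 without
  \<open>(A, Zn')\<close>-weighted one, and the second Davenport constant is the first plus one.\<close>

section \<open>Weighted zero sums as divisibility statements over the integers\<close>

lemma finsum_residue_ring:
  assumes "m > (1::int)"
  shows "(\<Oplus>\<^bsub>residue_ring m\<^esub>i\<in>{..<k::nat}. f i \<otimes>\<^bsub>residue_ring m\<^esub> g i) = (\<Sum>i<k. f i * g i) mod m"
proof -
  interpret residues m "residue_ring m"
    using assms by unfold_locales auto
  show ?thesis
  proof (induction k)
    case 0
    then show ?case by (simp add: res_zero_eq)
  next
    case (Suc k)
    have "(\<lambda>i. f i \<otimes>\<^bsub>residue_ring m\<^esub> g i) \<in> I \<rightarrow> carrier (residue_ring m)" for I
      by (auto simp: res_mult_eq)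
    then show ?case
      using Suc by (simp add: lessThan_Suc res_add_eq res_mult_eq add.commute mod_simps)
  qed
qed

lemma zero_Zn: "\<zero>\<^bsub>Zn n\<^esub> = 0"
  by (simp add: residue_ring_def)

lemma carrier_Zn: "carrier (Zn n) = {0..int n - 1}"
  by (simp add: residue_ring_def)

lemma mod_in_Zn'_iff:
  assumes "n \<ge> 2"
  shows "y mod int n \<in> Zn' n \<longleftrightarrow> \<not> int n dvd y"
  using assms by (auto simp: Zn'_def carrier_Zn zero_Zn mod_eq_0_iff_dvd)

lemma Zn'_not_dvd: "y \<in> Zn' n \<Longrightarrow> \<not> int n dvd y"
  by (auto simp: Zn'_def carrier_Zn zero_Zn dest: zdvd_imp_le)

lemma Units_Zn_coprime:
  assumes "n \<ge> 2" "y \<in> Units (Zn n)"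
  shows "coprime y (int n)"
proof -
  interpret residues "int n" "Zn n"
    using assms by unfold_locales auto
  show ?thesis using assms(2) by (simp add: res_units_eq)
qed

text \<open>Keeping each weight in a pair with its term means that splitting the sequence splits the
  weights too, so terms can be inserted or deleted without index arithmetic.\<close>

lemma weighted_zero_sum_iff:
  assumes "n \<ge> 2"
  shows "weighted_zero_sum n A x \<longleftrightarrow>
    (\<exists>zs. map snd zs = x \<and> fst ` set zs \<subseteq> A \<and> int n dvd (\<Sum>(a, y)\<leftarrow>zs. a * y))"
    (is "_ \<longleftrightarrow> (\<exists>zs. ?P zs)")
proof
  assume "weighted_zero_sum n A x"
  then obtain a where a: "length a = length x" "set a \<subseteq> A"
    "int n dvd (\<Sum>i<length x. a ! i * x ! i)"
    using assms by (auto simp: weighted_zero_sum_def finsum_residue_ring zero_Zn mod_eq_0_iff_dvd)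
  have "?P (zip a x)"
    using a by (auto simp: sum_list_sum_nth atLeast0LessThan dest: set_zip_leftD)
  then show "\<exists>zs. ?P zs" ..
next
  assume "\<exists>zs. ?P zs"
  then obtain zs where zs: "?P zs" ..
  then have "(\<Sum>i<length x. map fst zs ! i * x ! i) = (\<Sum>(a, y)\<leftarrow>zs. a * y)"
    by (auto simp: sum_list_sum_nth atLeast0LessThan case_prod_beta)
  then show "weighted_zero_sum n A x"
    unfolding weighted_zero_sum_def
    using assms zs
    by (intro exI[of _ "map fst zs"])
      (auto simp: finsum_residue_ring zero_Zn mod_eq_0_iff_dvd)
qed

lemma weighted_zero_sum2_iff:
  assumes "n \<ge> 2"
  shows "weighted_zero_sum2 n A B x \<longleftrightarrow>
    (\<exists>a b. length a = length x \<and> set a \<subseteq> A \<and> length b = length x \<and> set b \<subseteq> B \<and>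
      int n dvd (\<Sum>i<length x. a ! i * x ! i) \<and> int n dvd (\<Sum>i<length x. b ! i * a ! i))"
  using assms
  by (simp add: weighted_zero_sum2_def finsum_residue_ring zero_Zn mod_eq_0_iff_dvd)

text \<open>A term 0 contributes nothing under any weight; when it is inserted, non-emptiness of
  \<open>A\<close> supplies a weight for it.\<close>

lemma weighted_zero_sum_insert_zero:
  assumes "n \<ge> 2" "A \<noteq> {}"
  shows "weighted_zero_sum n A (u @ 0 # v) \<longleftrightarrow> weighted_zero_sum n A (u @ v)"
proof
  assume "weighted_zero_sum n A (u @ 0 # v)"
  then obtain p a q where "map snd p = u" "map snd q = v" "fst ` set (p @ (a, 0) # q) \<subseteq> A"
    "int n dvd (\<Sum>(a, y)\<leftarrow>p @ (a, 0) # q. a * y)"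
    using assms(1) by (fastforce simp: weighted_zero_sum_iff map_eq_append_conv map_eq_Cons_conv)
  then show "weighted_zero_sum n A (u @ v)"
    unfolding weighted_zero_sum_iff[OF assms(1)] by (intro exI[of _ "p @ q"]) auto
next
  assume "weighted_zero_sum n A (u @ v)"
  then obtain p q where "map snd p = u" "map snd q = v" "fst ` set (p @ q) \<subseteq> A"
    "int n dvd (\<Sum>(a, y)\<leftarrow>p @ q. a * y)"
    using assms(1) by (fastforce simp: weighted_zero_sum_iff map_eq_append_conv)
  moreover obtain a where "a \<in> A" using assms(2) by blast
  ultimately show "weighted_zero_sum n A (u @ 0 # v)"
    unfolding weighted_zero_sum_iff[OF assms(1)] by (intro exI[of _ "p @ (a, 0) # q"]) auto
qed

lemma weighted_zero_sum_singleton: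
  assumes "n \<ge> 2" "A \<subseteq> Units (Zn n)" "x \<in> carrier (Zn n)" "weighted_zero_sum n A [x]"
  shows "x = 0"
proof -
  obtain a where "a \<in> A" "int n dvd a * x"
    using assms(1,4) by (fastforce simp: weighted_zero_sum_iff map_eq_Cons_conv)
  moreover have "coprime (int n) a"
    using Units_Zn_coprime[of n a] \<open>a \<in> A\<close> assms(1,2) by (auto simp: coprime_commute)
  ultimately have "int n dvd x" by (simp add: coprime_dvd_mult_right_iff)
  then show ?thesis using assms(3) by (auto simp: carrier_Zn dest: zdvd_imp_le)
qed

section \<open>Nonzero residues orthogonal to a list of units\<close>

lemma dual_weights_pair:
  assumes "n \<ge> 2" "x \<in> Units (Zn n)" "y \<in> Units (Zn n)"
  shows "\<exists>b. length b = 2 \<and> set b \<subseteq> Zn' n \<and> int n dvd (\<Sum>i<2. b ! i * [x, y] ! i)"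
proof (intro exI conjI)
  \<comment> \<open>The sum is \<open>y * x - x * y\<close>, and both weights are units, hence
    nonzero modulo \<open>n\<close>.\<close>
  let ?b = "[y mod int n, (- x) mod int n]"
  have unit: "\<not> int n dvd z" if "coprime z (int n)" for z
    using that assms(1) by (auto simp: coprime_absorb_right)
  have "coprime x (int n)" "coprime y (int n)"
    using assms Units_Zn_coprime by auto
  then show "set ?b \<subseteq> Zn' n"
    using assms(1) unit by (simp add: mod_in_Zn'_iff)
  have "(y mod int n * x + (- x) mod int n * y) mod int n = (y * x + (- x) * y) mod int n"
    by (intro mod_add_cong mod_mult_left_eq)
  then show "int n dvd (\<Sum>i<2. ?b ! i * [x, y] ! i)"
    by (simp add: numeral_2_eq_2 mod_eq_0_iff_dvd)
qed simp

lemma dual_weights_triple: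
  assumes "n \<ge> 3" "x \<in> Units (Zn n)" "y \<in> Units (Zn n)" "z \<in> Units (Zn n)"
  shows "\<exists>b. length b = 3 \<and> set b \<subseteq> Zn' n \<and> int n dvd (\<Sum>i<3. b ! i * [x, y, z] ! i)"
proof (intro exI conjI)
  \<comment> \<open>Multiplied by \<open>x\<close>, \<open>y\<close>, \<open>z\<close> these weights
    give \<open>xyz\<close>, \<open>xyz\<close> and \<open>-2xyz\<close>.\<close>
  let ?b = "[(y * z) mod int n, (x * z) mod int n, (- 2 * (x * y)) mod int n]"
  have cop: "coprime x (int n)" "coprime y (int n)" "coprime z (int n)"
    using assms Units_Zn_coprime by auto
  have unit: "\<not> int n dvd c" if "coprime c (int n)" for c
    using that assms(1) by (auto simp: coprime_absorb_right)
  \<comment> \<open>The factor 2 need not be a unit, but cancelling the unit \<open>x * y\<close>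
    would leave \<open>n\<close> dividing 2, against \<open>n \<ge> 3\<close>.\<close>
  have "\<not> int n dvd 2 * (x * y)"
  proof
    assume "int n dvd 2 * (x * y)"
    moreover have "coprime (int n) (x * y)" using cop by (simp add: coprime_commute)
    ultimately have "int n dvd 2" by (simp add: coprime_dvd_mult_left_iff)
    then show False using assms(1) zdvd_imp_le[of "int n" 2] by simp
  qed
  then show "set ?b \<subseteq> Zn' n"
    using assms(1) cop unit by (simp add: mod_in_Zn'_iff)
  have "((y * z) mod int n * x + (x * z) mod int n * y + (- 2 * (x * y)) mod int n * z) mod int n
    = (y * z * x + x * z * y + - 2 * (x * y) * z) mod int n"
    by (intro mod_add_cong mod_mult_left_eq)
  also have "y * z * x + x * z * y + - 2 * (x * y) * z = 0" by (simp add: algebra_simps)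
  finally show "int n dvd (\<Sum>i<3. ?b ! i * [x, y, z] ! i)"
    by (simp add: numeral_3_eq_3 mod_eq_0_iff_dvd add.assoc)
qed simp

text \<open>Pairs are split off the front until two or three units remain, and the zero sums of the
  pieces add up. An odd length ends in a triple, which requires \<open>n \<ge> 3\<close>.\<close>

lemma dual_weights_exist:
  assumes "n \<ge> 2" "set a \<subseteq> Units (Zn n)" "length a \<ge> 2" "n \<ge> 3 \<or> length a = 2"
  shows "\<exists>b. length b = length a \<and> set b \<subseteq> Zn' n \<and> int n dvd (\<Sum>i<length a. b ! i * a ! i)"
  using assms(2-4)
proof (induction a rule: length_induct)
  case (1 a)
  then obtain x y c where a: "a = x # y # c"
    by (cases a rule: remdups_adj.cases) auto
  consider "c = []" | z where "c = [z]" | "length c \<ge> 2"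
    by (cases c rule: remdups_adj.cases) auto
  then show ?case
  proof cases
    case 1
    then show ?thesis using dual_weights_pair[of n x y] assms(1) "1.prems" a by (simp add: numeral_2_eq_2)
  next
    case 2
    then show ?thesis using dual_weights_triple[of n x y z] "1.prems" a by (simp add: numeral_3_eq_3)
  next
    case 3
    \<comment> \<open>The list has at least four entries, so the alternative
      \<open>length a = 2\<close> is excluded; this also lets the induction hypothesis apply to
      \<open>c\<close>.\<close>
    then have "n \<ge> 3" using "1.prems" a by auto
    then obtain b where b: "length b = length c" "set b \<subseteq> Zn' n"
      "int n dvd (\<Sum>i<length c. b ! i * c ! i)"
      using "1.IH"[rule_format, of c] "1.prems"(1) 3 a by auto
    obtain b' where b': "length b' = 2" "set b' \<subseteq> Zn' n" "int n dvd (\<Sum>i<2. b' ! i * [x, y] ! i)"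
      using dual_weights_pair[of n x y] assms(1) "1.prems" a by auto
    then obtain p q where pq: "b' = [p, q]"
      by (auto simp: length_Suc_conv numeral_2_eq_2)
    have "int n dvd (p * x + q * y) + (\<Sum>i<length c. b ! i * c ! i)"
      using b(3) b'(3) pq by (intro dvd_add[OF _ b(3)]) (simp add: numeral_2_eq_2)
    moreover have "(\<Sum>i<length a. (p # q # b) ! i * a ! i)
      = (p * x + q * y) + (\<Sum>i<length c. b ! i * c ! i)"
      by (simp add: a sum.lessThan_Suc_shift del: sum.lessThan_Suc)
    ultimately show ?thesis
      using b b' pq a by (intro exI[of _ "p # q # b"]) auto
  qed
qed

section \<open>Doubly weighted zero sums and the length condition\<close>

lemma weighted_zero_sum2_if_weighted_zero_sum:
  assumes "n \<ge> 2" "A \<subseteq> Units (Zn n)" "weighted_zero_sum n A T" "length T \<ge> 2"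
    "n \<ge> 3 \<or> length T = 2"
  shows "weighted_zero_sum2 n A (Zn' n) T"
proof -
  obtain a where a: "length a = length T" "set a \<subseteq> A"
    "int n dvd (\<Sum>i<length T. a ! i * T ! i)"
    using assms(1,3)
    by (auto simp: weighted_zero_sum_def finsum_residue_ring zero_Zn mod_eq_0_iff_dvd)
  then show ?thesis
    using dual_weights_exist[of n a] assms by (fastforce simp: weighted_zero_sum2_iff)
qed

text \<open>For a single term the dual equation reads \<open>b * a = 0\<close>; cancelling the unit
  \<open>a\<close> would make \<open>b\<close> zero.\<close>

lemma weighted_zero_sum2_length:
  assumes "n \<ge> 2" "A \<subseteq> Units (Zn n)" "weighted_zero_sum2 n A (Zn' n) T" "T \<noteq> []"
  shows "length T \<ge> 2"
proof (rule ccontr)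
  assume "\<not> length T \<ge> 2"
  then have "length T = 1" using assms(4) by (cases T rule: remdups_adj.cases) auto
  then obtain a b where ab: "a \<in> A" "b \<in> Zn' n" "int n dvd b * a"
    using assms(1,3) by (auto simp: weighted_zero_sum2_iff length_Suc_conv)
  then have "coprime (int n) a"
    using Units_Zn_coprime[of n a] assms(1,2) by (auto simp: coprime_commute)
  then have "int n dvd b" using ab by (simp add: coprime_dvd_mult_left_iff)
  then show False using ab Zn'_not_dvd by blast
qed

lemma subseq_imp_set_subset: "subseq xs ys \<Longrightarrow> set xs \<subseteq> set ys"
  by (auto elim: list_emb_set)

lemma has_zero_sum_subseq2_iff:
  assumes "n \<ge> 2" "A \<noteq> {}" "A \<subseteq> Units (Zn n)" "set S \<subseteq> carrier (Zn n)"
  shows "has_zero_sum_subseq2 n A (Zn' n) S \<longleftrightarrow>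
    (\<exists>T. subseq T S \<and> length T \<ge> 2 \<and> weighted_zero_sum n A T)"
proof
  assume "has_zero_sum_subseq2 n A (Zn' n) S"
  then show "\<exists>T. subseq T S \<and> length T \<ge> 2 \<and> weighted_zero_sum n A T"
    using weighted_zero_sum2_length[OF assms(1,3)]
    unfolding has_zero_sum_subseq2_def weighted_zero_sum_def weighted_zero_sum2_def by blast
next
  assume "\<exists>T. subseq T S \<and> length T \<ge> 2 \<and> weighted_zero_sum n A T"
  then obtain T where T: "subseq T S" "length T \<ge> 2" "weighted_zero_sum n A T" by blast
  show "has_zero_sum_subseq2 n A (Zn' n) S"
  proof (cases "n \<ge> 3 \<or> length T = 2")
    case True
    then have "weighted_zero_sum2 n A (Zn' n) T"
      using weighted_zero_sum2_if_weighted_zero_sum[OF assms(1,3)] T by blast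
    moreover have "T \<noteq> []" using T(2) by auto
    ultimately show ?thesis using T(1) unfolding has_zero_sum_subseq2_def by blast
  next
    case False
    \<comment> \<open>If the length of \<open>T\<close> is odd, no dual weights exist modulo 2, so
      \<open>T\<close> is replaced by two equal terms, found by pigeonhole in {0, 1}.\<close>
    then have n: "n = 2" and "length T > 2" using assms(1) T by auto
    have "set T \<subseteq> {0..int n - 1}"
      using subseq_imp_set_subset[OF T(1)] assms(4) unfolding carrier_Zn by (rule order.trans)
    then have "card (set T) \<le> 2" using card_mono[of "{0..int n - 1}" "set T"] n by simp
    then have "\<not> distinct T" using \<open>length T > 2\<close> by (auto dest: distinct_card)
    then obtain u v w x where "T = u @ [x] @ v @ [x] @ w" using not_distinct_decomp by blast
    then have "subseq [x, x] T" by (simp add: list_emb_append2 subseq_Cons2)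
    then have "subseq [x, x] S" using T(1) by (rule subseq_order.order_trans)
    moreover obtain a where "a \<in> A" using assms(2) by blast
    \<comment> \<open>With equal weights the sum is \<open>2 * a * x\<close>, which vanishes modulo
      2.\<close>
    then have "weighted_zero_sum n A [x, x]"
      unfolding weighted_zero_sum_iff[OF assms(1)]
      by (intro exI[of _ "[(a, x), (a, x)]"]) (simp add: n)
    then have "weighted_zero_sum2 n A (Zn' n) [x, x]"
      using weighted_zero_sum2_if_weighted_zero_sum[OF assms(1,3)] by simp
    ultimately show ?thesis unfolding has_zero_sum_subseq2_def by blast
  qed
qed

section \<open>Deleting one zero term\<close>

lemma subseq_remove1: "subseq T S \<Longrightarrow> subseq (remove1 x T) (remove1 x S)"
proof (induction rule: list_emb.induct)
  case (list_emb_Cons T S y)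
  \<comment> \<open>Needed when the skipped head \<open>y\<close> equals \<open>x\<close>: the
    longer list loses only \<open>y\<close>, while \<open>T\<close> may lose a later occurrence,
    which only shrinks it.\<close>
  have "subseq (remove1 x T) T" by (induction T) auto
  then show ?case using list_emb_Cons by (auto intro: subseq_order.order_trans)
qed auto

text \<open>The zero pays for the length condition: deleting a zero from a zero sum of length at
  least 2 leaves it non-empty, and inserting a zero into a non-empty one raises its length to at
  least 2.\<close>

lemma has_zero_sum_subseq2_zero_mem_iff:
  assumes "n \<ge> 2" "A \<noteq> {}" "A \<subseteq> Units (Zn n)" "set S \<subseteq> carrier (Zn n)" "0 \<in> set S"
  shows "has_zero_sum_subseq2 n A (Zn' n) S \<longleftrightarrow> has_zero_sum_subseq n A (remove1 0 S)"
proof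
  assume "has_zero_sum_subseq2 n A (Zn' n) S"
  then obtain T where T: "subseq T S" "length T \<ge> 2" "weighted_zero_sum n A T"
    using has_zero_sum_subseq2_iff[OF assms(1-4)] by blast
  have "weighted_zero_sum n A (remove1 0 T)"
  proof (cases "0 \<in> set T")
    case True
    then obtain u v where "T = u @ 0 # v" "0 \<notin> set u" by (meson split_list_first)
    then show ?thesis
      using T(3) weighted_zero_sum_insert_zero[OF assms(1,2)] by (simp add: remove1_append)
  qed (simp add: T(3) remove1_idem)
  moreover have "length (remove1 0 T) > 0" using T(2) by (auto simp: length_remove1)
  ultimately show "has_zero_sum_subseq n A (remove1 0 S)"
    using subseq_remove1[OF T(1)] unfolding has_zero_sum_subseq_def by blast
next
  assume "has_zero_sum_subseq n A (remove1 0 S)"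
  then obtain T where T: "T \<noteq> []" "subseq T (remove1 0 S)" "weighted_zero_sum n A T"
    unfolding has_zero_sum_subseq_def by blast
  \<comment> \<open>Splitting at the first zero makes \<open>remove1 0 S\<close> equal to
    \<open>u @ v\<close>, so \<open>T\<close> can be cut at the same place and the zero put back
    there.\<close>
  obtain u v where S: "S = u @ 0 # v" "0 \<notin> set u" using assms(5) by (meson split_list_first)
  then obtain p q where pq: "T = p @ q" "subseq p u" "subseq q v"
    using T(2) by (auto simp: remove1_append elim: subseq_appendE)
  have "weighted_zero_sum n A (p @ 0 # q)"
    using T(3) pq weighted_zero_sum_insert_zero[OF assms(1,2)] by simp
  moreover have "subseq (p @ 0 # q) S" using S pq by (auto intro: list_emb_append_mono)
  moreover have "length (p @ 0 # q) \<ge> 2" using T(1) pq by (cases p; cases q) auto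
  ultimately show "has_zero_sum_subseq2 n A (Zn' n) S"
    using has_zero_sum_subseq2_iff[OF assms(1-4)] by blast
qed

text \<open>As the weights are units, a zero sum of length one consists of the term 0; without zeros
  every zero sum is long enough.\<close>

lemma has_zero_sum_subseq2_if_zero_notin:
  assumes "n \<ge> 2" "A \<noteq> {}" "A \<subseteq> Units (Zn n)" "set S \<subseteq> carrier (Zn n)" "0 \<notin> set S"
    and "has_zero_sum_subseq n A S"
  shows "has_zero_sum_subseq2 n A (Zn' n) S"
proof -
  obtain T where T: "T \<noteq> []" "subseq T S" "weighted_zero_sum n A T"
    using assms(6) unfolding has_zero_sum_subseq_def by blast
  have "set T \<subseteq> set S" using T(2) by (rule subseq_imp_set_subset)
  have "length T \<ge> 2"
  proof (rule ccontr)
    assume "\<not> length T \<ge> 2"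
    then obtain x where x: "T = [x]" using T(1) by (cases T rule: remdups_adj.cases) auto
    then show False
      using weighted_zero_sum_singleton[OF assms(1,3), of x] T(3) \<open>set T \<subseteq> set S\<close> assms(4,5) by auto
  qed
  then show ?thesis using has_zero_sum_subseq2_iff[OF assms(1-4)] T by blast
qed

section \<open>The two Davenport constants\<close>

lemma has_zero_sum_subseq_length_n:
  assumes "n \<ge> 2" "A \<noteq> {}" "length S = n"
  shows "has_zero_sum_subseq n A S"
proof -
  \<comment> \<open>The \<open>n + 1\<close> prefix sums fall into \<open>n\<close> residue classes,
    so two agree and the block between them has sum 0 modulo \<open>n\<close>.\<close>
  define p where "p i = sum_list (take i S) mod int n" for i
  have "p ` {..n} \<subseteq> {0..<int n}" using assms(1) by (auto simp: p_def)
  then have "card (p ` {..n}) \<le> n" using card_mono[of "{0..<int n}"] by fastforce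
  then have "\<not> inj_on p {..n}" by (auto dest: card_image)
  then obtain i j where ij: "i < j" "j \<le> n" "p i = p j"
    by (metis (no_types, lifting) atMost_iff inj_onI linorder_neqE_nat)
  define T where "T = take (j - i) (drop i S)"
  have split: "take j S = take i S @ T"
    using ij take_add[of i "j - i" S] by (simp add: T_def)
  have "int n dvd sum_list (take j S) - sum_list (take i S)"
    using ij(3)[symmetric] by (simp add: p_def mod_eq_dvd_iff)
  then have dvd: "int n dvd sum_list T" by (simp add: split)
  \<comment> \<open>One constant weight on the whole block suffices.\<close>
  obtain a where a: "a \<in> A" using assms(2) by blast
  have "(\<Sum>(a, y)\<leftarrow>map (Pair a) T. a * y) = a * sum_list T"
    by (simp add: o_def sum_list_const_mult)
  then have "weighted_zero_sum n A T"
    unfolding weighted_zero_sum_iff[OF assms(1)] using a dvd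
    by (intro exI[of _ "map (Pair a) T"]) (auto simp: o_def)
  moreover have "subseq T S"
    unfolding T_def by (meson sublist_drop sublist_imp_subseq sublist_order.order_trans sublist_take)
  moreover have "T \<noteq> []" using ij assms(3) by (simp add: T_def)
  ultimately show ?thesis unfolding has_zero_sum_subseq_def by blast
qed

text \<open>Length \<open>n\<close> witnesses that the \<open>LEAST\<close> is taken over a
  non-empty set, so the constant really has its defining property.\<close>

lemma Davenport_props:
  assumes "n \<ge> 2" "A \<noteq> {}"
  shows "Davenport n A > 0 \<and>
    (\<forall>S. set S \<subseteq> carrier (Zn n) \<and> length S = Davenport n A \<longrightarrow> has_zero_sum_subseq n A S)"
  unfolding Davenport_def
  by (rule LeastI[of _ n]) (use assms has_zero_sum_subseq_length_n in auto)

lemma has_zero_sum_subseq_mono: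
  "subseq S S' \<Longrightarrow> has_zero_sum_subseq n A S \<Longrightarrow> has_zero_sum_subseq n A S'"
  unfolding has_zero_sum_subseq_def by (blast intro: subseq_order.order_trans)

lemma has_zero_sum_subseq_if_length_ge:
  assumes "n \<ge> 2" "A \<noteq> {}" "set S \<subseteq> carrier (Zn n)" "length S \<ge> Davenport n A"
  shows "has_zero_sum_subseq n A S"
proof -
  have "subseq (take (Davenport n A) S) S"
    by (simp add: sublist_imp_subseq)
  moreover have "set (take (Davenport n A) S) \<subseteq> carrier (Zn n)"
    using assms(3) set_take_subset[of _ S] by (rule order.trans[rotated])
  then have "has_zero_sum_subseq n A (take (Davenport n A) S)"
    using Davenport_props[OF assms(1,2)] assms(4) by simp
  ultimately show ?thesis by (rule has_zero_sum_subseq_mono)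
qed

lemma zero_sum_free_exists:
  assumes "k < Davenport n A"
  shows "\<exists>S. set S \<subseteq> carrier (Zn n) \<and> length S = k \<and> \<not> has_zero_sum_subseq n A S"
proof (cases "k = 0")
  \<comment> \<open>Minimality concerns positive lengths only; length 0 is settled by the empty
    sequence, which has no non-empty subsequence.\<close>
  case True
  then show ?thesis by (simp add: has_zero_sum_subseq_def)
next
  case False
  then show ?thesis
    using not_less_Least[OF assms[unfolded Davenport_def]] by auto
qed

lemma Davenport2_eq:
  assumes "n \<ge> 2" "A \<noteq> {}" "A \<subseteq> Units (Zn n)"
  shows "Davenport2 n A (Zn' n) = Davenport n A + 1"
  unfolding Davenport2_def
proof (rule Least_equality, intro conjI allI impI)
  fix S assume S: "set S \<subseteq> carrier (Zn n) \<and> length S = Davenport n A + 1"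
  show "has_zero_sum_subseq2 n A (Zn' n) S"
  proof (cases "0 \<in> set S")
    case True
    have "set (remove1 0 S) \<subseteq> carrier (Zn n)"
      using S set_remove1_subset by fast
    then have "has_zero_sum_subseq n A (remove1 0 S)"
      using S True has_zero_sum_subseq_if_length_ge[OF assms(1,2)] by (simp add: length_remove1)
    then show ?thesis using has_zero_sum_subseq2_zero_mem_iff assms S True by blast
  next
    case False
    then show ?thesis
      using S has_zero_sum_subseq_if_length_ge has_zero_sum_subseq2_if_zero_notin assms by simp
  qed
next
  fix k
  assume k: "0 < k \<and> (\<forall>S. set S \<subseteq> carrier (Zn n) \<and> length S = k \<longrightarrow>
    has_zero_sum_subseq2 n A (Zn' n) S)"
  show "Davenport n A + 1 \<le> k"
  proof (rule ccontr)
    assume "\<not> Davenport n A + 1 \<le> k"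
    then have "k - 1 < Davenport n A" using k by auto
    then obtain S where S: "set S \<subseteq> carrier (Zn n)" "length S = k - 1"
      "\<not> has_zero_sum_subseq n A S"
      using zero_sum_free_exists by blast
    \<comment> \<open>Lower bound: a zero put in front of a zero-sum-free sequence of length
      \<open>k - 1\<close> contradicts the choice of \<open>k\<close>.\<close>
    have "set (0 # S) \<subseteq> carrier (Zn n)" using S assms(1) by (auto simp: carrier_Zn)
    then have "has_zero_sum_subseq2 n A (Zn' n) (0 # S)"
      and "\<not> has_zero_sum_subseq2 n A (Zn' n) (0 # S)"
      using S k has_zero_sum_subseq2_zero_mem_iff[OF assms, of "0 # S"] by auto
    then show False by blast
  qed
qed simp

theorem theorem18:
  fixes n :: nat and A :: "int set" and S :: "int list"
  assumes "n \<ge> 2"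
    and "A \<noteq> {}" and "A \<subseteq> Units (Zn n)"
    and "set S \<subseteq> carrier (Zn n)"
  shows "D_extremal2 n A (Zn' n) S \<longleftrightarrow>
    \<zero>\<^bsub>Zn n\<^esub> \<in> set S \<and> D_extremal n A (remove1 \<zero>\<^bsub>Zn n\<^esub> S)"
proof (cases "0 \<in> set S")
  case True
  \<comment> \<open>Both \<open>length S\<close> and the Davenport constant are positive, so the
    truncated subtractions lose nothing.\<close>
  then have "length S \<ge> 1" by (cases S) auto
  then have "length S = Davenport n A \<longleftrightarrow> length (remove1 0 S) = Davenport n A - 1"
    using True Davenport_props[OF assms(1,2)] by (auto simp: length_remove1 simp del: length_0_conv)
  moreover have "set (remove1 0 S) \<subseteq> carrier (Zn n)"
    using assms(4) set_remove1_subset by fast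
  ultimately show ?thesis
    using True assms has_zero_sum_subseq2_zero_mem_iff[OF assms True]
    by (auto simp: D_extremal_def D_extremal2_def Davenport2_eq zero_Zn)
next
  case False
  \<comment> \<open>An extremal \<open>S\<close> would have length \<open>Davenport n A\<close>,
    which already forces an \<open>A\<close>-weighted zero sum; without zeros this yields a doubly
    weighted one.\<close>
  have "\<not> D_extremal2 n A (Zn' n) S"
    using False assms has_zero_sum_subseq_if_length_ge has_zero_sum_subseq2_if_zero_notin
    by (auto simp: D_extremal2_def Davenport2_eq)
  then show ?thesis using False by (simp add: zero_Zn)
qed

end
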